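(* For $n, m \in \mathbb{N}$, let $kr^c_{1-2}(n,m)$ be the number of partitions $\lambda_1 \le \lambda_2 \le \cdots \le \lambda_m$ of $n$ into $m$ parts with difference at least three at distance three such that if parts at distance two differ by at most one, then their sum, together with the intermediate part, is $\equiv 1 \pmod{3}$. Then $$\sum_{m,n \geq 0} kr^c_{1-2}(n,m)\, q^n x^m = \sum_{\substack{n_1, n_3 \geq 0 \\ n_2 > 0}} \frac{ q^{ ( 9n_3^2 - n_3 )/2 + 2n_2^2 + n_2 + n_1^2 + 6n_3n_2 + 3n_3n_1 + 2n_2n_1 - 1 }\, (1 + q)(-q; q^2)_{n_2 - 1}\, x^{3n_3 + 2n_2 + n_1} }{ (q; q)_{n_1} (q^2; q^2)_{n_2} (q^3; q^3)_{n_3} } + \sum_{n_1, n_3 \geq 0} \frac{ q^{ ( 9n_3^2 - n_3 )/2 + n_1^2 + 3n_3n_1 }\, x^{3n_3 + n_1} }{ (q; q)_{n_1} (q^3; q^3)_{n_3} }$$ $$= \sum_{n_1, n_2, n_3 \geq 0} \frac{ q^{ ( 9n_3^2 - n_3 )/2 + 2n_2^2 + n_2 + n_1^2 + 6n_3n_2 + 3n_3n_1 + 2n_2n_1}\, (-1/q; q^2)_{n_2}\, x^{3n_3 + 2n_2 + n_1} }{ (q; q)_{n_1} (q^2; q^2)_{n_2} (q^3; q^3)_{n_3} }.$$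
   Context: $\mathbb{N}=\{0,1,2,\dots\}$. A partition of $n$ into $m$ parts is a non-decreasing sequence $\lambda_1 \le \cdots \le \lambda_m$ of positive integers with sum $n$ (the empty partition is the unique partition of $0$, with $m=0$; it satisfies all the conditions vacuously). "Difference at least $k$ at distance $d$" means $\lambda_{j+d}-\lambda_j \ge k$ for all $1 \le j \le m-d$. The condition on parts at distance two says: for each $1\le j \le m-2$, if $\lambda_{j+2}-\lambda_j \le 1$ then $\lambda_j+\lambda_{j+1}+\lambda_{j+2}$ is in the stated residue class modulo $3$. The $q$-Pochhammer symbol is $(a;q)_n = \prod_{j=1}^{n}(1-aq^{j-1})$, with $(a;q)_0=1$. The identities are between formal power series in $q$ and $x$. The superscript $c$ and subscript $1-2$ in $kr^c_{1-2}$ are merely labels. *)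

theory Defs
  imports "HOL-Analysis.Infinite_Sum" "HOL-Computational_Algebra.Formal_Laurent_Series"
    "HOL-Number_Theory.Cong"
begin

definition partition_into :: "nat \<Rightarrow> nat \<Rightarrow> nat list \<Rightarrow> bool" where
  "partition_into n m ps \<longleftrightarrow>
     sorted ps \<and> (\<forall>p \<in> set ps. 0 < p) \<and> length ps = m \<and> sum_list ps = n"

text \<open>Below, list indices start at 0, so \<open>ps ! j\<close> is the part \<open>\<lambda>\<^sub>j\<^sub>+\<^sub>1\<close>.\<close>

definition difference_at_distance :: "nat \<Rightarrow> nat \<Rightarrow> nat list \<Rightarrow> bool" where
  "difference_at_distance k d ps \<longleftrightarrow>
     (\<forall>j. j + d < length ps \<longrightarrow> int (ps ! (j + d)) - int (ps ! j) \<ge> int k)"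

definition distance_two_cond :: "nat \<Rightarrow> nat list \<Rightarrow> bool" where
  "distance_two_cond r ps \<longleftrightarrow>
     (\<forall>j. j + 2 < length ps \<longrightarrow> int (ps ! (j + 2)) - int (ps ! j) \<le> 1 \<longrightarrow>
        [ps ! j + ps ! (j + 1) + ps ! (j + 2) = r] (mod 3))"

definition kr_c_1_2 :: "nat \<Rightarrow> nat \<Rightarrow> nat" where
  "kr_c_1_2 n m = card {ps. partition_into n m ps \<and>
     difference_at_distance 3 3 ps \<and> distance_two_cond 1 ps}"

definition qpochhammer :: "'a::comm_ring_1 \<Rightarrow> 'a \<Rightarrow> nat \<Rightarrow> 'a" where
  "qpochhammer a q n = (\<Prod>j = 1..n. 1 - a * q ^ (j - 1))"

text \<open>
  Bivariate series live in \<open>rat fls fps\<close>: the outer power series variable is \<open>x\<close>, and the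
  coefficients are Laurent series in \<open>q\<close>, because \<open>-1/q\<close> occurs as a Pochhammer argument.
  Infinite sums in this type refer to the library's metric on \<open>fps\<close>, that is, to \<open>x\<close>-adic
  convergence: every coefficient of a power of \<open>x\<close> is eventually constant.
  For fixed \<open>m\<close>, infinitely many \<open>q\<^sup>n x\<^sup>m\<close> can have nonzero coefficients, so their double series
  need not converge in this topology; \<open>gen_fun\<close> therefore specifies it by its coefficients.
\<close>

definition xmonom :: "rat fls \<Rightarrow> nat \<Rightarrow> rat fls fps" where
  "xmonom c k = fps_const c * fps_X ^ k"

definition gen_fun :: "(nat \<Rightarrow> nat \<Rightarrow> nat) \<Rightarrow> rat fls fps" where
  "gen_fun a = Abs_fps (\<lambda>m. fps_to_fls (Abs_fps (\<lambda>n. of_nat (a n m))))"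

end

theory Submission
  imports Defs
begin

text \<open>
  Let \<open>F(x)\<close> be the generating function of the partitions in question and \<open>G(x)\<close> that of those
  with at most one part 1, where \<open>x\<close> marks the number of parts. Removing the smallest
  parts and lowering the others shows that
  \<open>F(x) = G(x) + q\<^sup>2 x\<^sup>2 G(x q\<^sup>2) + q\<^sup>4 x\<^sup>3 F(x q\<^sup>3)\<close> and \<open>G(x) = F(x q) + q x G(x q)\<close>
  (lemmas \<open>kr_series_KR\<close> and \<open>kr_series_KR_single\<close>). The terms of the first equation correspond
  to partitions with at most one 1, those that begin with \<open>1, 1\<close> and have no 2, and those that begin with
  \<open>1, 1, 2\<close>. Iterating the second equation once gives
  \<open>G(x) = F(x q) + q x F(x q\<^sup>2) + q\<^sup>3 x\<^sup>2 G(x q\<^sup>2)\<close>.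

  The three-fold sum satisfies the same two equations, with a companion sum
  in the role of \<open>G\<close> (lemmas \<open>kr_sum_equation\<close> and \<open>kr_sum_single_equation\<close>). This is a
  termwise computation: the difference of two summands is written as a combination of the factors
  \<open>1 - q ^ n1\<close>, \<open>1 - q ^ (2 n2)\<close>, \<open>1 - q ^ (3 n3)\<close>, each of which cancels the last factor of one
  denominator, and then that index is shifted by one. As a solution with given constant term is unique
  (lemma \<open>kr_system_unique\<close>), the two series agree.

  The remaining equality of the two forms of the sum only separates the terms with \<open>n2 = 0\<close>
  and uses \<open>(-1/q; q\<^sup>2)\<^sub>n = (1 + 1/q) (-q; q\<^sup>2)\<^sub>n\<^sub>-\<^sub>1\<close> in the others.
\<close>

section \<open>Series in x: dilations, index shifts and infinite sums\<close>

text \<open>The substitution of \<open>c x\<close> for \<open>x\<close>. With \<open>c = q ^ k\<close> it records that \<open>k\<close> is added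
  to every part of a partition.\<close>

definition dilate :: "'a::comm_ring_1 \<Rightarrow> 'a fps \<Rightarrow> 'a fps" where
  "dilate c f = Abs_fps (\<lambda>m. c ^ m * f $ m)"

lemma dilate_nth [simp]: "dilate c f $ m = c ^ m * f $ m"
  by (simp add: dilate_def)

text \<open>This is the sum of the monomials \<open>t i x ^ w i\<close> provided that \<open>w\<close> has finite fibres; an infinite
  fibre would give the coefficient zero.\<close>

definition weighted_sum :: "('i \<Rightarrow> nat) \<Rightarrow> ('i \<Rightarrow> 'a::comm_ring_1) \<Rightarrow> 'a fps" where
  "weighted_sum w t = Abs_fps (\<lambda>m. \<Sum>i | w i = m. t i)"

lemma weighted_sum_nth [simp]: "weighted_sum w t $ m = (\<Sum>i | w i = m. t i)"
  by (simp add: weighted_sum_def)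

lemma weighted_sum_add:
  "weighted_sum w (\<lambda>i. s i + t i) = weighted_sum w s + weighted_sum w t"
  by (rule fps_ext) (simp add: sum.distrib)

lemma weighted_sum_const:
  "fps_const c * weighted_sum w t = weighted_sum w (\<lambda>i. c * t i)"
  by (rule fps_ext) (simp add: sum_distrib_left)

lemma dilate_weighted_sum:
  "dilate c (weighted_sum w t) = weighted_sum w (\<lambda>i. c ^ w i * t i)"
  by (rule fps_ext) (simp add: sum_distrib_left)

text \<open>An index shift such as \<open>n \<mapsto> n + 1\<close> in a sum whose term at \<open>n = 0\<close> vanishes; it
  costs the power \<open>x ^ d\<close> by which the shift raises the weight.\<close>

lemma weighted_sum_reindex:
  assumes fin: "\<And>m. finite {i. w i = m}"
    and inj: "inj s"
    and weight: "\<And>j. w (s j) = w' j + d"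
    and supp: "\<And>i. i \<notin> range s \<Longrightarrow> t i = 0"
  shows "weighted_sum w t = fps_X ^ d * weighted_sum w' (t \<circ> s)"
proof (rule fps_ext)
  fix m
  have "(\<Sum>i | w i = m. t i) = (\<Sum>i\<in>s ` {j. w' j + d = m}. t i)"
  proof (rule sum.mono_neutral_right)
    show "\<forall>i \<in> {i. w i = m} - s ` {j. w' j + d = m}. t i = 0"
    proof
      fix i assume "i \<in> {i. w i = m} - s ` {j. w' j + d = m}"
      then have "i \<notin> range s" using weight by auto
      then show "t i = 0" by (rule supp)
    qed
  qed (use fin weight in auto)
  also have "\<dots> = (\<Sum>j | w' j + d = m. t (s j))"
    by (rule sum.reindex[THEN trans]) (use inj in \<open>auto simp: inj_def inj_on_def\<close>)
  finally show "weighted_sum w t $ m = (fps_X ^ d * weighted_sum w' (t \<circ> s)) $ m"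
    by (auto simp: fps_X_power_mult_nth intro!: sum.cong)
qed

text \<open>Each coefficient receives only finitely many terms, so the family converges \<open>x\<close>-adically over
  every index set.\<close>

lemma has_sum_xmonom:
  assumes fin: "\<And>m. finite {i. w i = m}"
  shows "((\<lambda>i. xmonom (c i) (w i)) has_sum
          weighted_sum w (\<lambda>i. if i \<in> I then c i else 0)) I"
proof (rule has_sum_fpsI)
  have nth: "xmonom (c i) (w i) $ m = (if w i = m then c i else 0)" for i m
    by (simp add: xmonom_def)
  show "finite {i \<in> I. xmonom (c i) (w i) $ m \<noteq> 0}" for m
    by (rule finite_subset[OF _ fin[of m]]) (auto simp: nth split: if_splits)
  show "weighted_sum w (\<lambda>i. if i \<in> I then c i else 0) $ m =
      (\<Sum>i | i \<in> I \<and> xmonom (c i) (w i) $ m \<noteq> 0. xmonom (c i) (w i) $ m)" for m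
    unfolding weighted_sum_nth
    by (rule sum.mono_neutral_cong_right[OF fin])
       (auto simp: nth split: if_splits)
qed

section \<open>The system of q-difference equations\<close>

text \<open>The pair of \<open>q\<close>-difference equations
  \<open>F(x) = G(x) + q\<^sup>2 x\<^sup>2 G(x q\<^sup>2) + q\<^sup>4 x\<^sup>3 F(x q\<^sup>3)\<close> and
  \<open>G(x) = F(x q) + q x F(x q\<^sup>2) + q\<^sup>3 x\<^sup>2 G(x q\<^sup>2)\<close>.
  Counting partitions gives the second equation in the shorter form
  \<open>G(x) = F(x q) + q x G(x q)\<close>. Substituting this once into itself yields the form above, which for
  the multiple sums results termwise from index shifts.\<close>

definition kr_system :: "'a::comm_ring_1 \<Rightarrow> 'a fps \<Rightarrow> 'a fps \<Rightarrow> bool" where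
  "kr_system q F G \<longleftrightarrow>
     F = G + fps_const (q ^ 2) * fps_X ^ 2 * dilate (q ^ 2) G
           + fps_const (q ^ 4) * fps_X ^ 3 * dilate (q ^ 3) F \<and>
     G = dilate q F + fps_const q * fps_X * dilate (q ^ 2) F
           + fps_const (q ^ 3) * fps_X ^ 2 * dilate (q ^ 2) G"

text \<open>In degree \<open>m\<close> the equations say that \<open>f\<^sub>m = g\<^sub>m + \<dots>\<close> and
  \<open>g\<^sub>m = q ^ m f\<^sub>m + \<dots>\<close>, up to coefficients of lower degree. Eliminating \<open>g\<^sub>m\<close> leaves the factor
  \<open>1 - q ^ m\<close> in front of \<open>f\<^sub>m\<close>, which vanishes only for \<open>m = 0\<close>.\<close>

lemma kr_system_unique:
  fixes q :: "'a::idom"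
  assumes not_root: "\<And>m. 0 < m \<Longrightarrow> q ^ m \<noteq> 1"
    and sys: "kr_system q F G" "kr_system q F' G'"
    and init: "F $ 0 = F' $ 0"
  shows "F = F'"
proof -
  have "F $ m = F' $ m \<and> G $ m = G' $ m" for m
  proof (induction m rule: less_induct)
    case (less m)
    let ?a = "\<lambda>H. if m < 2 then 0 else q ^ 2 * (q ^ 2) ^ (m - 2) * H $ (m - 2)"
    let ?b = "\<lambda>H. if m < 3 then 0 else q ^ 4 * (q ^ 3) ^ (m - 3) * H $ (m - 3)"
    let ?c = "\<lambda>H. if m < 1 then 0 else q * (q ^ 2) ^ (m - 1) * H $ (m - 1)"
    let ?d = "\<lambda>H. if m < 2 then 0 else q ^ 3 * (q ^ 2) ^ (m - 2) * H $ (m - 2)"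
    have coeffs: "H $ m = K $ m + ?a K + ?b H \<and> K $ m = q ^ m * H $ m + ?c H + ?d K"
      if "kr_system q H K" for H K
    proof -
      have H: "H $ m = (K + fps_const (q ^ 2) * fps_X ^ 2 * dilate (q ^ 2) K
           + fps_const (q ^ 4) * fps_X ^ 3 * dilate (q ^ 3) H) $ m"
        and K: "K $ m = (dilate q H + fps_const q * fps_X * dilate (q ^ 2) H
           + fps_const (q ^ 3) * fps_X ^ 2 * dilate (q ^ 2) K) $ m"
        using that unfolding kr_system_def by metis+
      show ?thesis
        by (subst H, subst K) (simp add: mult.assoc fps_X_power_mult_nth)
    qed
    have lower: "?a G = ?a G'" "?b F = ?b F'" "?c F = ?c F'" "?d G = ?d G'"
      using less.IH by auto
    note eqs = coeffs[OF sys(1), unfolded lower] coeffs[OF sys(2)]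
    have F: "F $ m - F' $ m = G $ m - G' $ m"
      by (subst eqs(1)[THEN conjunct1], subst eqs(2)[THEN conjunct1]) simp
    have G: "G $ m - G' $ m = q ^ m * (F $ m - F' $ m)"
      by (subst eqs(1)[THEN conjunct2], subst eqs(2)[THEN conjunct2]) (simp add: right_diff_distrib)
    show ?case
    proof (cases "m = 0")
      case True
      then show ?thesis using init F by simp
    next
      case False
      from F G have "(1 - q ^ m) * (F $ m - F' $ m) = 0"
        by (simp add: left_diff_distrib)
      moreover have "1 - q ^ m \<noteq> 0"
        using not_root[of m] False by simp
      ultimately show ?thesis using F by simp
    qed
  qed
  then show ?thesis by (simp add: fps_ext)
qed

section \<open>The partitions, sorted by their smallest parts\<close>

definition kr_partition :: "nat list \<Rightarrow> bool" where
  "kr_partition ps \<longleftrightarrow> sorted ps \<and> (\<forall>p \<in> set ps. 0 < p) \<and>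
     difference_at_distance 3 3 ps \<and> distance_two_cond 1 ps"

lemma difference_at_distance_Cons:
  "difference_at_distance k (Suc d) (x # xs) \<longleftrightarrow>
     (d < length xs \<longrightarrow> x + k \<le> xs ! d) \<and> difference_at_distance k (Suc d) xs"
proof -
  have all: "(\<forall>j. P j) \<longleftrightarrow> P 0 \<and> (\<forall>j. P (Suc j))" for P :: "nat \<Rightarrow> bool"
    by (metis not0_implies_Suc)
  show ?thesis
    unfolding difference_at_distance_def by (subst all) auto
qed

lemma distance_two_cond_Cons:
  "distance_two_cond r (x # xs) \<longleftrightarrow>
     (1 < length xs \<longrightarrow> xs ! 1 \<le> x + 1 \<longrightarrow> [x + xs ! 0 + xs ! 1 = r] (mod 3)) \<and>
     distance_two_cond r xs"
proof -
  have all: "(\<forall>j. P j) \<longleftrightarrow> P 0 \<and> (\<forall>j. P (Suc j))" for P :: "nat \<Rightarrow> bool"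
    by (metis not0_implies_Suc)
  show ?thesis
    unfolding distance_two_cond_def by (subst all) auto
qed

lemma kr_partition_Nil [simp]: "kr_partition []"
  by (simp add: kr_partition_def difference_at_distance_def distance_two_cond_def)

text \<open>The conditions are local, so prepending a part adds only the constraints that involve the
  new part and the next three. This is what makes counting by the smallest parts possible.\<close>

lemma kr_partition_Cons:
  "kr_partition (x # xs) \<longleftrightarrow> 0 < x \<and> (\<forall>y \<in> set xs. x \<le> y) \<and>
     (1 < length xs \<longrightarrow> xs ! 1 \<le> x + 1 \<longrightarrow> (x + xs ! 0 + xs ! 1) mod 3 = 1) \<and>
     (2 < length xs \<longrightarrow> x + 3 \<le> xs ! 2) \<and> kr_partition xs"
  using difference_at_distance_Cons[of 3 2 x xs]
  by (auto simp: kr_partition_def distance_two_cond_Cons cong_def)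

definition raise :: "nat \<Rightarrow> nat list \<Rightarrow> nat list" where
  "raise k ps = map (\<lambda>p. p + k) ps"

lemma raise_simps [simp]:
  "raise k [] = []"
  "raise k (p # ps) = (p + k) # raise k ps"
  "length (raise k ps) = length ps"
  "set (raise k ps) = (\<lambda>p. p + k) ` set ps"
  by (simp_all add: raise_def)

lemma nth_raise [simp]:
  "i < length ps \<Longrightarrow> raise k ps ! i = ps ! i + k"
  "Suc 0 < length ps \<Longrightarrow> raise k ps ! 0 = ps ! 0 + k"
  unfolding raise_def by (subst nth_map; auto)+

lemma sum_list_raise [simp]: "sum_list (raise k ps) = sum_list ps + k * length ps"
  by (induction ps) simp_all

lemma raise_eq_iff [simp]: "raise k ps = raise k rs \<longleftrightarrow> ps = rs"
  by (simp add: raise_def inj_def)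

text \<open>The conditions involve only differences of parts and sums of three parts modulo 3, and raising
  three parts by \<open>k\<close> adds \<open>3 k\<close> to their sum.\<close>

lemma kr_partition_raise:
  assumes "\<forall>p \<in> set ps. 0 < p"
  shows "kr_partition (raise k ps) \<longleftrightarrow> kr_partition ps"
  using assms
proof (induction ps)
  case (Cons x xs)
  have mod: "(x + k + (y + k) + (z + k)) mod 3 = (x + y + z) mod 3" for y z
    by presburger
  have "kr_partition (raise k (x # xs)) \<longleftrightarrow> 0 < x \<and> (\<forall>y \<in> set xs. x \<le> y) \<and>
     (1 < length xs \<longrightarrow> xs ! 1 \<le> x + 1 \<longrightarrow> (x + k + (xs ! 0 + k) + (xs ! 1 + k)) mod 3 = 1) \<and>
     (2 < length xs \<longrightarrow> x + 3 \<le> xs ! 2) \<and> kr_partition (raise k xs)"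
    using Cons.prems by (auto simp: kr_partition_Cons)
  then show ?case
    using Cons unfolding mod by (simp add: kr_partition_Cons)
qed simp

lemma kr_partition_pos: "kr_partition ps \<Longrightarrow> p \<in> set ps \<Longrightarrow> 0 < p"
  by (auto simp: kr_partition_def)

lemma kr_partition_raiseI: "kr_partition ps \<Longrightarrow> kr_partition (raise k ps)"
  using kr_partition_raise kr_partition_pos by blast

lemma kr_partition_nth:
  assumes "kr_partition ps"
  shows "i < length ps \<Longrightarrow> 0 < ps ! i"
    and "1 < length ps \<Longrightarrow> ps ! 0 \<le> ps ! 1"
    and "2 < length ps \<Longrightarrow> ps ! 1 \<le> ps ! 2"
    and "2 < length ps \<Longrightarrow> ps ! 2 \<le> ps ! 0 + 1 \<Longrightarrow> (ps ! 0 + ps ! 1 + ps ! 2) mod 3 = 1"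
proof -
  show "i < length ps \<Longrightarrow> 0 < ps ! i"
    using kr_partition_pos[OF assms] by simp
  show "1 < length ps \<Longrightarrow> ps ! 0 \<le> ps ! 1" "2 < length ps \<Longrightarrow> ps ! 1 \<le> ps ! 2"
    using assms by (auto simp: kr_partition_def sorted_iff_nth_mono)
  show "2 < length ps \<Longrightarrow> ps ! 2 \<le> ps ! 0 + 1 \<Longrightarrow> (ps ! 0 + ps ! 1 + ps ! 2) mod 3 = 1"
    using assms by (cases ps) (auto simp: kr_partition_Cons)
qed

text \<open>Otherwise the three smallest parts would be 1, with the forbidden residue 0.\<close>

lemma kr_partition_third:
  assumes "kr_partition ps" "2 < length ps"
  shows "1 < ps ! 2"
proof (rule ccontr)
  assume "\<not> 1 < ps ! 2"
  then have "ps ! 0 = 1" "ps ! 1 = 1" "ps ! 2 = 1"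
    using kr_partition_nth(1)[OF assms(1), of 0] kr_partition_nth(2,3)[OF assms(1)] assms(2) by linarith+
  then show False using kr_partition_nth(4)[OF assms] by simp
qed

lemma kr_partition_lowered:
  assumes "kr_partition ps" "\<forall>p \<in> set ps. k < p"
  obtains rs where "kr_partition rs" "ps = raise k rs"
proof
  show eq: "ps = raise k (map (\<lambda>p. p - k) ps)"
    using assms(2) by (induction ps) auto
  show "kr_partition (map (\<lambda>p. p - k) ps)"
    using kr_partition_raise[of "map (\<lambda>p. p - k) ps" k] assms eq by auto
qed

definition KR :: "nat list set" where
  "KR = {ps. kr_partition ps}"

text \<open>As the lists are sorted, these are the partitions with at most one part 1.\<close>

definition KR_single :: "nat list set" where
  "KR_single = {ps \<in> KR. \<not> (\<exists>rs. ps = 1 # 1 # rs)}"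

lemma KR_single_second:
  assumes "ps \<in> KR_single" "1 < length ps"
  shows "1 < ps ! 1"
proof (rule ccontr)
  assume "\<not> 1 < ps ! 1"
  moreover have "kr_partition ps" using assms(1) by (simp add: KR_single_def KR_def)
  ultimately have "ps ! 0 = 1" "ps ! 1 = 1"
    using kr_partition_nth(1)[of ps 0] kr_partition_nth(2)[of ps] assms(2) by linarith+
  then have "\<exists>rs. ps = 1 # 1 # rs"
    using assms(2) by (cases ps; cases "tl ps") auto
  then show False using assms(1) by (simp add: KR_single_def)
qed

text \<open>Either there is no part 1, and lowering all parts by 1 gives an arbitrary partition; or there
  is exactly one, and then 2 occurs at most once, because \<open>1 + 2 + 2\<close> has the forbidden residue 2.
  Conversely, putting 1 in front of such parts violates no condition: the difference condition
  could only fail if the next three parts were \<open>2, 3, 3\<close> or \<open>3, 3, 3\<close>, and these are themselves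
  excluded by their residues.\<close>

lemma KR_single_decomp:
  "KR_single = raise 1 ` KR \<union> (\<lambda>ps. 1 # raise 1 ps) ` KR_single"
proof (intro equalityI subsetI)
  fix ps assume ps: "ps \<in> KR_single"
  then have kr: "kr_partition ps" and no: "\<nexists>rs. ps = 1 # 1 # rs"
    by (auto simp: KR_single_def KR_def)
  show "ps \<in> raise 1 ` KR \<union> (\<lambda>ps. 1 # raise 1 ps) ` KR_single"
  proof (cases "\<exists>rs. ps = 1 # rs")
    case True
    then obtain rs where rs: "ps = 1 # rs" by blast
    have "\<forall>p \<in> set rs. 1 < p"
    proof (cases rs)
      case (Cons y ys)
      then have "1 < y" using no rs kr by (auto simp: kr_partition_Cons)
      then show ?thesis using Cons rs kr by (auto simp: kr_partition_Cons)
    qed simp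
    moreover have "kr_partition rs" using kr rs by (simp add: kr_partition_Cons)
    ultimately obtain ss where ss: "kr_partition ss" "rs = raise 1 ss"
      using kr_partition_lowered by metis
    have "\<nexists>us. ss = 1 # 1 # us"
      using kr ss(2) rs by (auto simp: kr_partition_Cons)
    then show ?thesis using ss rs by (auto simp: KR_single_def KR_def)
  next
    case False
    have "\<forall>p \<in> set ps. 1 < p"
    proof (cases ps)
      case (Cons y ys)
      then have "1 < y" using False kr by (auto simp: kr_partition_Cons)
      then show ?thesis using Cons kr by (auto simp: kr_partition_Cons)
    qed simp
    with kr obtain ss where "kr_partition ss" "ps = raise 1 ss"
      using kr_partition_lowered by metis
    then show ?thesis by (auto simp: KR_def)
  qed
next
  fix ps assume "ps \<in> raise 1 ` KR \<union> (\<lambda>ps. 1 # raise 1 ps) ` KR_single"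
  then consider rs where "rs \<in> KR" "ps = raise 1 rs"
    | rs where "rs \<in> KR_single" "ps = 1 # raise 1 rs" by auto
  then show "ps \<in> KR_single"
  proof cases
    case 1
    then have "kr_partition ps"
      using kr_partition_raiseI by (simp add: KR_def)
    moreover have "1 \<notin> set ps"
      using 1 kr_partition_pos[of rs] by (auto simp: KR_def)
    ultimately show ?thesis by (auto simp: KR_single_def KR_def)
  next
    case 2
    then have rs: "kr_partition rs"
      by (auto simp: KR_single_def KR_def)
    have two: "1 < rs ! 1" if "1 < length rs"
      using KR_single_second[OF 2(1) that] .
    have three: "2 < rs ! 2" if "2 < length rs"
    proof (rule ccontr)
      assume "\<not> 2 < rs ! 2"
      then have "rs ! 1 = 2" "rs ! 2 = 2" "rs ! 0 = 1 \<or> rs ! 0 = 2"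
        using kr_partition_nth(1)[OF rs, of 0] kr_partition_nth(2,3)[OF rs] two that by linarith+
      then show False using kr_partition_nth(4)[OF rs that] by auto
    qed
    have kr: "kr_partition ps"
      unfolding 2(2) kr_partition_Cons
      using two three kr_partition_raiseI[OF rs] by auto
    have "1 \<notin> set (raise 1 rs)"
      using kr_partition_pos[OF rs] by auto
    then have "\<nexists>us. raise 1 rs = 1 # us" by (metis list.set_intros(1))
    then show ?thesis using 2 kr by (auto simp: KR_single_def KR_def)
  qed
qed

text \<open>After \<open>1, 1\<close> a third 1 is excluded by the residue. If 2 follows, then all later parts are at
  least 4, by the difference condition for the first part. If 2 does not follow, then 3 occurs at
  most once, since \<open>1, 1, 3, 3\<close> violates the difference condition. Conversely, these bounds imply the conditions that link the
  added parts to the others, given that no partition has three parts 1.\<close>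

lemma KR_decomp:
  "KR = KR_single \<union> ((\<lambda>ps. 1 # 1 # raise 2 ps) ` KR_single \<union>
                      (\<lambda>ps. 1 # 1 # 2 # raise 3 ps) ` KR)"
proof (intro equalityI subsetI)
  fix ps assume "ps \<in> KR"
  then have kr: "kr_partition ps" by (simp add: KR_def)
  show "ps \<in> KR_single \<union> ((\<lambda>ps. 1 # 1 # raise 2 ps) ` KR_single \<union>
                      (\<lambda>ps. 1 # 1 # 2 # raise 3 ps) ` KR)"
  proof (cases "\<exists>rs. ps = 1 # 1 # rs")
    case False
    then show ?thesis using kr by (simp add: KR_single_def KR_def)
  next
    case True
    then obtain rs where rs: "ps = 1 # 1 # rs" by blast
    show ?thesis
    proof (cases "\<exists>us. rs = 2 # us")
      case True
      then obtain us where us: "rs = 2 # us" by blast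
      have "\<forall>p \<in> set us. 3 < p"
      proof (cases us)
        case (Cons y ys)
        then have "3 < y" using us rs kr by (auto simp: kr_partition_Cons)
        then show ?thesis using Cons us rs kr by (auto simp: kr_partition_Cons)
      qed simp
      moreover have "kr_partition us" using kr rs us by (simp add: kr_partition_Cons)
      ultimately obtain ss where "kr_partition ss" "us = raise 3 ss"
        using kr_partition_lowered by metis
      then show ?thesis using us rs by (auto simp: KR_def)
    next
      case False
      have "\<forall>p \<in> set rs. 2 < p"
      proof (cases rs)
        case (Cons y ys)
        then have "2 < y" using False rs kr
          by (cases "y = 1") (auto simp: kr_partition_Cons)
        then show ?thesis using Cons rs kr by (auto simp: kr_partition_Cons)
      qed simp
      moreover have "kr_partition rs" using kr rs by (simp add: kr_partition_Cons)
      ultimately obtain ss where ss: "kr_partition ss" "rs = raise 2 ss"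
        using kr_partition_lowered by metis
      have "\<nexists>us. ss = 1 # 1 # us"
        using kr ss(2) rs by (auto simp: kr_partition_Cons)
      then show ?thesis using ss rs by (auto simp: KR_single_def KR_def)
    qed
  qed
next
  fix ps assume "ps \<in> KR_single \<union> ((\<lambda>ps. 1 # 1 # raise 2 ps) ` KR_single \<union>
                      (\<lambda>ps. 1 # 1 # 2 # raise 3 ps) ` KR)"
  then consider "ps \<in> KR_single"
    | rs where "rs \<in> KR_single" "ps = 1 # 1 # raise 2 rs"
    | rs where "rs \<in> KR" "ps = 1 # 1 # 2 # raise 3 rs" by auto
  then show "ps \<in> KR"
  proof cases
    case 1
    then show ?thesis by (simp add: KR_single_def)
  next
    case 2
    then have rs: "kr_partition rs"
      by (auto simp: KR_single_def KR_def)
    have two: "1 < rs ! 1" if "1 < length rs"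
      using KR_single_second[OF 2(1) that] .
    have "kr_partition (1 # raise 2 rs)"
      unfolding kr_partition_Cons
      using kr_partition_raiseI[OF rs] kr_partition_third[OF rs] kr_partition_nth(1)[OF rs, of 1] by force
    moreover have "kr_partition (1 # 1 # raise 2 rs) \<longleftrightarrow> kr_partition (1 # raise 2 rs)"
      using two kr_partition_pos[OF rs] kr_partition_nth(1)[OF rs, of 1]
      by (subst kr_partition_Cons) (auto simp: nth_Cons')
    ultimately show ?thesis using 2 by (simp add: KR_def)
  next
    case 3
    then have rs: "kr_partition rs" by (auto simp: KR_def)
    have r: "kr_partition (2 # raise 3 rs)"
      unfolding kr_partition_Cons
      using kr_partition_raiseI[OF rs] kr_partition_third[OF rs] kr_partition_nth(1)[OF rs, of 1] by force
    have "kr_partition (1 # 2 # raise 3 rs)"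
      by (subst kr_partition_Cons)
         (use r kr_partition_nth(1)[OF rs, of 1] in \<open>auto simp: nth_Cons'\<close>)
    then have "kr_partition (1 # 1 # 2 # raise 3 rs)"
      by (subst kr_partition_Cons)
         (use kr_partition_nth(1)[OF rs, of 0] in \<open>auto simp: nth_Cons'\<close>)
    then show ?thesis using 3 by (simp add: KR_def)
  qed
qed

section \<open>Generating functions of the partitions\<close>

definition kr_series :: "nat list set \<Rightarrow> rat fls fps" where
  "kr_series S = gen_fun (\<lambda>n m. card {ps \<in> S. length ps = m \<and> sum_list ps = n})"

lemma kr_series_nth:
  "kr_series S $ m = fps_to_fls (Abs_fps (\<lambda>n. of_nat (card {ps \<in> S. length ps = m \<and> sum_list ps = n})))"
  by (simp add: kr_series_def gen_fun_def)

lemma kr_series_Un: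
  assumes "S \<inter> T = {}"
  shows "kr_series (S \<union> T) = kr_series S + kr_series T"
proof (rule fps_ext)
  fix m
  have fin: "finite {ps \<in> U. length ps = m \<and> sum_list ps = n}" for U :: "nat list set" and n
  proof (rule finite_subset)
    show "{ps \<in> U. length ps = m \<and> sum_list ps = n} \<subseteq> {ps. set ps \<subseteq> {..n} \<and> length ps = m}"
      by (auto simp: member_le_sum_list)
  qed (simp add: finite_lists_length_eq)
  have "card {ps \<in> S \<union> T. length ps = m \<and> sum_list ps = n} =
      card {ps \<in> S. length ps = m \<and> sum_list ps = n} + card {ps \<in> T. length ps = m \<and> sum_list ps = n}" for n
    by (subst card_Un_disjoint[symmetric, OF fin fin]) (use assms in \<open>auto intro!: arg_cong[of _ _ card]\<close>)
  then show "kr_series (S \<union> T) $ m = (kr_series S + kr_series T) $ m"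
    by (simp add: kr_series_nth fps_plus_def flip: fps_to_fls_plus)
qed

text \<open>The intended \<open>g\<close> prepends \<open>d\<close> parts of sum \<open>c\<close> and raises the other parts by \<open>k\<close>. The raising
  contributes \<open>q ^ k\<close> for each of these parts, so it turns \<open>x\<close> into \<open>q ^ k x\<close>.\<close>

lemma kr_series_image:
  assumes inj: "inj_on g S"
    and len: "\<And>ps. length (g ps) = length ps + d"
    and sum: "\<And>ps. sum_list (g ps) = sum_list ps + c + k * length ps"
  shows "kr_series (g ` S) = fps_const (fls_X ^ c) * fps_X ^ d * dilate (fls_X ^ k) (kr_series S)"
proof (rule fps_ext)
  fix m
  show "kr_series (g ` S) $ m =
      (fps_const (fls_X ^ c) * fps_X ^ d * dilate (fls_X ^ k) (kr_series S)) $ m"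
  proof (cases "m < d")
    case True
    then have "card {ps \<in> g ` S. length ps = m \<and> sum_list ps = n} = 0" for n
      using len by (auto intro!: arg_cong[of _ "{}" card, simplified])
    then show ?thesis
      using True by (simp del: card_eq_0_iff add: kr_series_nth mult.assoc fps_X_power_mult_nth fps_zero_def[symmetric])
  next
    case False
    then obtain r where r: "m = r + d" by (metis add.commute le_Suc_ex not_less)
    let ?e = "c + k * r"
    have "card {ps \<in> g ` S. length ps = m \<and> sum_list ps = n} =
        (if n < ?e then 0 else card {ps \<in> S. length ps = r \<and> sum_list ps = n - ?e})" for n
    proof -
      have "{ps \<in> g ` S. length ps = m \<and> sum_list ps = n} =
          g ` {ps \<in> S. length ps = r \<and> sum_list ps + ?e = n}"
        using len sum r by (auto simp: add.assoc)
      moreover have "inj_on g {ps \<in> S. length ps = r \<and> sum_list ps + ?e = n}"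
        using inj by (rule inj_on_subset) auto
      ultimately have "card {ps \<in> g ` S. length ps = m \<and> sum_list ps = n} =
          card {ps \<in> S. length ps = r \<and> sum_list ps + ?e = n}"
        by (simp add: card_image)
      also have "{ps \<in> S. length ps = r \<and> sum_list ps + ?e = n} =
          (if n < ?e then {} else {ps \<in> S. length ps = r \<and> sum_list ps = n - ?e})"
        by auto
      finally show ?thesis by simp
    qed
    then have "Abs_fps (\<lambda>n. of_nat (card {ps \<in> g ` S. length ps = m \<and> sum_list ps = n}) :: rat) =
        fps_X ^ ?e * Abs_fps (\<lambda>n. of_nat (card {ps \<in> S. length ps = r \<and> sum_list ps = n}))"
      by (intro fps_ext) (simp add: fps_X_power_mult_nth)
    then have "kr_series (g ` S) $ m = fls_X ^ ?e * kr_series S $ r"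
      by (simp add: kr_series_nth fls_times_fps_to_fls fps_to_fls_power)
    then show ?thesis
      using r by (simp add: mult.assoc fps_X_power_mult_nth power_add power_mult)
  qed
qed

lemma kr_series_KR_single:
  "kr_series KR_single = dilate fls_X (kr_series KR)
     + fps_const fls_X * fps_X * dilate fls_X (kr_series KR_single)"
proof -
  have "raise 1 ` KR \<inter> (\<lambda>ps. 1 # raise 1 ps) ` KR_single = {}"
  proof -
    have "1 \<notin> set (raise 1 ps)" if "ps \<in> KR" for ps
      using that kr_partition_pos[of ps] by (force simp: KR_def)
    then show ?thesis by (metis (no_types, lifting) disjoint_iff imageE list.set_intros(1))
  qed
  then have "kr_series KR_single = kr_series (raise 1 ` KR) + kr_series ((\<lambda>ps. 1 # raise 1 ps) ` KR_single)"
    by (subst KR_single_decomp) (rule kr_series_Un)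
  also have "kr_series (raise 1 ` KR) = dilate fls_X (kr_series KR)"
    using kr_series_image[of "raise 1" KR 0 0 1] by (simp add: inj_on_def)
  also have "kr_series ((\<lambda>ps. 1 # raise 1 ps) ` KR_single) =
      fps_const fls_X * fps_X * dilate fls_X (kr_series KR_single)"
    using kr_series_image[of "\<lambda>ps. 1 # raise 1 ps" KR_single 1 1 1] by (simp add: inj_on_def)
  finally show ?thesis .
qed

lemma kr_series_KR:
  "kr_series KR = kr_series KR_single
     + fps_const (fls_X ^ 2) * fps_X ^ 2 * dilate (fls_X ^ 2) (kr_series KR_single)
     + fps_const (fls_X ^ 4) * fps_X ^ 3 * dilate (fls_X ^ 3) (kr_series KR)"
proof -
  let ?two = "(\<lambda>ps. 1 # 1 # raise 2 ps) ` KR_single"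
    and ?three = "(\<lambda>ps. 1 # 1 # 2 # raise 3 ps) ` KR"
  have "2 \<notin> set (raise 2 ps)" if "ps \<in> KR_single" for ps
    using that kr_partition_pos[of ps] by (force simp: KR_single_def KR_def)
  then have "?two \<inter> ?three = {}"
    by (smt (verit) disjoint_iff imageE list.inject list.set_intros(1))
  moreover have "KR_single \<inter> (?two \<union> ?three) = {}"
    by (auto simp: KR_single_def)
  ultimately have "kr_series KR = kr_series KR_single + (kr_series ?two + kr_series ?three)"
    by (subst KR_decomp) (simp add: kr_series_Un)
  also have "kr_series ?two =
      fps_const (fls_X ^ 2) * fps_X ^ 2 * dilate (fls_X ^ 2) (kr_series KR_single)"
    by (rule kr_series_image) (auto simp: inj_on_def)
  also have "kr_series ?three =
      fps_const (fls_X ^ 4) * fps_X ^ 3 * dilate (fls_X ^ 3) (kr_series KR)"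
    by (rule kr_series_image) (auto simp: inj_on_def)
  finally show ?thesis by (simp add: add.assoc)
qed

text \<open>The second equation of the system arises by substituting the equation for \<open>KR_single\<close> into itself.\<close>

lemma kr_system_kr_series: "kr_system fls_X (kr_series KR) (kr_series KR_single)"
  unfolding kr_system_def
proof
  have "dilate fls_X (kr_series KR_single) = dilate (fls_X ^ 2) (kr_series KR)
      + fps_const (fls_X ^ 2) * fps_X * dilate (fls_X ^ 2) (kr_series KR_single)"
  proof (rule fps_ext)
    fix m
    have "kr_series KR_single $ m = (dilate fls_X (kr_series KR)
        + fps_const fls_X * fps_X * dilate fls_X (kr_series KR_single)) $ m"
      by (subst kr_series_KR_single) (rule refl)
    then show "dilate fls_X (kr_series KR_single) $ m = (dilate (fls_X ^ 2) (kr_series KR)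
        + fps_const (fls_X ^ 2) * fps_X * dilate (fls_X ^ 2) (kr_series KR_single)) $ m"
      by (cases m) (simp_all add: mult.assoc algebra_simps power_add power2_eq_square power_mult_distrib)
  qed
  then show "kr_series KR_single = dilate fls_X (kr_series KR)
     + fps_const fls_X * fps_X * dilate (fls_X ^ 2) (kr_series KR)
     + fps_const (fls_X ^ 3) * fps_X ^ 2 * dilate (fls_X ^ 2) (kr_series KR_single)"
    by (subst kr_series_KR_single)
       (simp add: algebra_simps power2_eq_square eval_nat_numeral flip: fps_const_mult)
qed (fact kr_series_KR)

lemma gen_fun_kr_c_1_2: "gen_fun kr_c_1_2 = kr_series KR"
proof -
  have "kr_c_1_2 = (\<lambda>n m. card {ps \<in> KR. length ps = m \<and> sum_list ps = n})"
    unfolding kr_c_1_2_def partition_into_def KR_def kr_partition_def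
    by (intro ext arg_cong[of _ _ card]) auto
  then show ?thesis by (simp only: kr_series_def)
qed

lemma kr_series_nth_0: "kr_series KR $ 0 = 1"
proof -
  have "{ps \<in> KR. length ps = 0 \<and> sum_list ps = n} = (if n = 0 then {[]} else {})" for n
    by (auto simp: KR_def)
  then have "kr_series KR $ 0 = fps_to_fls (Abs_fps (\<lambda>n. if n = 0 then 1 else 0))"
    unfolding kr_series_nth by (intro arg_cong[of _ _ fps_to_fls] fps_ext) simp
  then show ?thesis by (simp add: fps_one_def[symmetric])
qed

section \<open>The three-fold sums satisfy the system\<close>

lemma qpochhammer_0 [simp]: "qpochhammer a q 0 = 1"
  by (simp add: qpochhammer_def)

lemma qpochhammer_Suc: "qpochhammer a q (Suc n) = qpochhammer a q n * (1 - a * q ^ n)"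
  by (simp add: qpochhammer_def)

lemma qpochhammer_Suc_left: "qpochhammer a q (Suc n) = (1 - a) * qpochhammer (a * q) q n"
  by (induction n) (simp_all add: qpochhammer_Suc mult.assoc)

fun kr_weight :: "nat \<times> nat \<times> nat \<Rightarrow> nat" where
  "kr_weight (n1, n2, n3) = 3 * n3 + 2 * n2 + n1"

lemma finite_kr_weight: "finite {i. kr_weight i = m}"
proof (rule finite_subset)
  show "{i. kr_weight i = m} \<subseteq> {..m} \<times> {..m} \<times> {..m}" by auto
qed simp

text \<open>The truncated subtraction and the division are exact, because \<open>n3 \<le> 9 * n3\<^sup>2\<close> and
  \<open>n3 * (9 * n3 - 1)\<close> is even.\<close>

definition kr_exponent :: "nat \<Rightarrow> nat \<Rightarrow> nat \<Rightarrow> nat" where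
  "kr_exponent n1 n2 n3 = (9 * n3\<^sup>2 - n3) div 2 + 2 * n2\<^sup>2 + n2 + n1\<^sup>2
     + 6 * n3 * n2 + 3 * n3 * n1 + 2 * n2 * n1"

lemma kr_exponent_Suc:
  "kr_exponent (Suc n1) n2 n3 = kr_exponent n1 n2 n3 + (2 * n1 + 2 * n2 + 3 * n3 + 1)"
  "kr_exponent n1 (Suc n2) n3 = kr_exponent n1 n2 n3 + (2 * n1 + 4 * n2 + 6 * n3 + 3)"
  "kr_exponent n1 n2 (Suc n3) = kr_exponent n1 n2 n3 + (3 * n1 + 6 * n2 + 9 * n3 + 4)"
proof -
  have "n3 \<le> 9 * n3\<^sup>2"
    by (cases n3) (simp_all add: power2_eq_square)
  then have "9 * (Suc n3)\<^sup>2 - Suc n3 = 9 * n3\<^sup>2 - n3 + (9 * n3 + 4) * 2"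
    by (simp add: power2_eq_square algebra_simps)
  then have "(9 * (Suc n3)\<^sup>2 - Suc n3) div 2 = (9 * n3\<^sup>2 - n3) div 2 + (9 * n3 + 4)"
    by (metis add.commute div_mult_self1 zero_neq_numeral)
  then show
    "kr_exponent n1 n2 (Suc n3) = kr_exponent n1 n2 n3 + (3 * n1 + 6 * n2 + 9 * n3 + 4)"
    unfolding kr_exponent_def by (simp add: algebra_simps)
qed (simp_all add: kr_exponent_def power2_eq_square algebra_simps)

text \<open>This is the part of the summand that the two sums below share; they differ in a factor that depends
  on \<open>n2\<close> and \<open>n3\<close> only.\<close>

definition kr_term :: "'a::field \<Rightarrow> nat \<Rightarrow> nat \<Rightarrow> nat \<Rightarrow> 'a" where
  "kr_term q n1 n2 n3 = q ^ kr_exponent n1 n2 n3 /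
     (qpochhammer q q n1 * qpochhammer (q\<^sup>2) (q\<^sup>2) n2 * qpochhammer (q ^ 3) (q ^ 3) n3)"

definition pair_factor :: "'a::field \<Rightarrow> nat \<Rightarrow> 'a" where
  "pair_factor q n = qpochhammer (- 1 / q) (q\<^sup>2) n"

definition pair_factor_single :: "'a::field \<Rightarrow> nat \<Rightarrow> 'a" where
  "pair_factor_single q n = qpochhammer (- q) (q\<^sup>2) n"

lemma pair_factor_0 [simp]: "pair_factor q 0 = 1" and pair_factor_single_0 [simp]: "pair_factor_single q 0 = 1"
  by (simp_all add: pair_factor_def pair_factor_single_def)

lemma pair_factor_Suc: "q \<noteq> 0 \<Longrightarrow> pair_factor q (Suc n) = (1 + 1 / q) * pair_factor_single q n"
  by (simp add: pair_factor_def pair_factor_single_def qpochhammer_Suc_left power2_eq_square)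

lemma pair_factor_single_Suc: "pair_factor_single q (Suc n) = (1 + q ^ (2 * n + 1)) * pair_factor_single q n"
  by (simp add: pair_factor_single_def qpochhammer_Suc power_mult)

definition kr_sum :: "'a::field \<Rightarrow> 'a fps" where
  "kr_sum q = weighted_sum kr_weight (\<lambda>(n1, n2, n3). kr_term q n1 n2 n3 * pair_factor q n2)"

text \<open>The sum for partitions with at most one part 1. Its first factors are suggested by the
  smallest configurations: the least triple becomes \<open>2 + 2 + 3\<close> instead of \<open>1 + 1 + 2\<close>, whence
  \<open>q ^ (3 * n3)\<close>, and the least pairs become \<open>1 + 2, 2 + 2\<close> instead of \<open>1 + 1, 1 + 2\<close>, whence
  \<open>- q\<close> in place of \<open>- 1 / q\<close>.\<close>

definition kr_sum_single :: "'a::field \<Rightarrow> 'a fps" where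
  "kr_sum_single q =
     weighted_sum kr_weight (\<lambda>(n1, n2, n3). kr_term q n1 n2 n3 * q ^ (3 * n3) * pair_factor_single q n2)"

lemma fps_nth_0_kr_sum: "kr_sum q $ 0 = 1"
proof -
  have "{i. kr_weight i = 0} = {(0, 0, 0)}" by auto
  then show ?thesis
    by (simp add: kr_sum_def kr_term_def kr_exponent_def)
qed

lemma kr_weighted_sum_shift:
  "(\<And>n2 n3. t (0, n2, n3) = 0) \<Longrightarrow> weighted_sum kr_weight t =
     fps_X * weighted_sum kr_weight (\<lambda>(n1, n2, n3). t (Suc n1, n2, n3))"
  "(\<And>n1 n3. t (n1, 0, n3) = 0) \<Longrightarrow> weighted_sum kr_weight t =
     fps_X ^ 2 * weighted_sum kr_weight (\<lambda>(n1, n2, n3). t (n1, Suc n2, n3))"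
  "(\<And>n1 n2. t (n1, n2, 0) = 0) \<Longrightarrow> weighted_sum kr_weight t =
     fps_X ^ 3 * weighted_sum kr_weight (\<lambda>(n1, n2, n3). t (n1, n2, Suc n3))"
proof -
  let ?s1 = "\<lambda>(n1, n2, n3). (Suc n1, n2, n3)" and ?s2 = "\<lambda>(n1, n2, n3). (n1, Suc n2, n3)"
    and ?s3 = "\<lambda>(n1, n2, n3). (n1, n2, Suc n3)"
  have range1: "(n1, n2, n3) \<in> range ?s1" if "n1 \<noteq> 0" for n1 n2 n3 :: nat
    using that by (intro range_eqI[of _ _ "(n1 - 1, n2, n3)"]) simp
  have range2: "(n1, n2, n3) \<in> range ?s2" if "n2 \<noteq> 0" for n1 n2 n3 :: nat
    using that by (intro range_eqI[of _ _ "(n1, n2 - 1, n3)"]) simp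
  have range3: "(n1, n2, n3) \<in> range ?s3" if "n3 \<noteq> 0" for n1 n2 n3 :: nat
    using that by (intro range_eqI[of _ _ "(n1, n2, n3 - 1)"]) simp
  show "weighted_sum kr_weight t =
     fps_X * weighted_sum kr_weight (\<lambda>(n1, n2, n3). t (Suc n1, n2, n3))"
    if zero: "\<And>n2 n3. t (0, n2, n3) = 0"
  proof -
    have "weighted_sum kr_weight t = fps_X ^ 1 * weighted_sum kr_weight (t \<circ> ?s1)"
    proof (rule weighted_sum_reindex[OF finite_kr_weight])
      show "t i = 0" if "i \<notin> range ?s1" for i
        using that range1 zero by (metis prod_cases3)
    qed (auto simp: inj_def)
    also have "t \<circ> ?s1 = (\<lambda>(n1, n2, n3). t (Suc n1, n2, n3))" by auto
    finally show ?thesis by simp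
  qed
  show "weighted_sum kr_weight t =
     fps_X ^ 2 * weighted_sum kr_weight (\<lambda>(n1, n2, n3). t (n1, Suc n2, n3))"
    if zero: "\<And>n1 n3. t (n1, 0, n3) = 0"
  proof -
    have "weighted_sum kr_weight t = fps_X ^ 2 * weighted_sum kr_weight (t \<circ> ?s2)"
    proof (rule weighted_sum_reindex[OF finite_kr_weight])
      show "t i = 0" if "i \<notin> range ?s2" for i
        using that range2 zero by (metis prod_cases3)
    qed (auto simp: inj_def)
    also have "t \<circ> ?s2 = (\<lambda>(n1, n2, n3). t (n1, Suc n2, n3))" by auto
    finally show ?thesis .
  qed
  show "weighted_sum kr_weight t =
     fps_X ^ 3 * weighted_sum kr_weight (\<lambda>(n1, n2, n3). t (n1, n2, Suc n3))"
    if zero: "\<And>n1 n2. t (n1, n2, 0) = 0"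
  proof -
    have "weighted_sum kr_weight t = fps_X ^ 3 * weighted_sum kr_weight (t \<circ> ?s3)"
    proof (rule weighted_sum_reindex[OF finite_kr_weight])
      show "t i = 0" if "i \<notin> range ?s3" for i
        using that range3 zero by (metis prod_cases3)
    qed (auto simp: inj_def)
    also have "t \<circ> ?s3 = (\<lambda>(n1, n2, n3). t (n1, n2, Suc n3))" by auto
    finally show ?thesis .
  qed
qed

context
  fixes q :: "'a::field"
  assumes q_nonzero: "q \<noteq> 0"
    and not_root: "\<And>m. 0 < m \<Longrightarrow> q ^ m \<noteq> 1"
begin

text \<open>One step in an index multiplies the term by a power of \<open>q\<close> and divides it by the new
  factor of the Pochhammer symbol belonging to that index. So a term multiplied by this factor
  vanishes at index zero, and after an index shift it is again a term.\<close>

lemma kr_term_Suc: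
  "kr_term q (Suc n1) n2 n3 * (1 - q ^ Suc n1) = q ^ (2 * n1 + 2 * n2 + 3 * n3 + 1) * kr_term q n1 n2 n3"
  "kr_term q n1 (Suc n2) n3 * (1 - q ^ (2 * Suc n2)) = q ^ (2 * n1 + 4 * n2 + 6 * n3 + 3) * kr_term q n1 n2 n3"
  "kr_term q n1 n2 (Suc n3) * (1 - q ^ (3 * Suc n3)) = q ^ (3 * n1 + 6 * n2 + 9 * n3 + 4) * kr_term q n1 n2 n3"
proof -
  have nz: "1 - q ^ m \<noteq> 0" if "0 < m" for m
    using not_root[OF that] by simp
  have P: "qpochhammer (q ^ k) (q ^ k) (Suc n) = qpochhammer (q ^ k) (q ^ k) n * (1 - q ^ (k * Suc n))" for k n
    by (simp add: qpochhammer_Suc power_add flip: power_mult)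
  have P1: "qpochhammer q q (Suc n) = qpochhammer q q n * (1 - q ^ Suc n)" for n
    by (simp add: qpochhammer_Suc)
  have cancel: "q ^ (e + k) / (a * f * b * c) * f = q ^ k * (q ^ e / (a * b * c))"
    "q ^ (e + k) / (a * (b * f) * c) * f = q ^ k * (q ^ e / (a * b * c))"
    "q ^ (e + k) / (a * b * (c * f)) * f = q ^ k * (q ^ e / (a * b * c))"
    if "f \<noteq> 0" for e k and a b c f :: 'a
    using that by (simp_all add: power_add mult_ac)
  show "kr_term q (Suc n1) n2 n3 * (1 - q ^ Suc n1) = q ^ (2 * n1 + 2 * n2 + 3 * n3 + 1) * kr_term q n1 n2 n3"
    unfolding kr_term_def kr_exponent_Suc P1 by (rule cancel(1)[OF nz]) simp
  show "kr_term q n1 (Suc n2) n3 * (1 - q ^ (2 * Suc n2)) = q ^ (2 * n1 + 4 * n2 + 6 * n3 + 3) * kr_term q n1 n2 n3"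
    unfolding kr_term_def kr_exponent_Suc P by (rule cancel(2)[OF nz]) simp
  show "kr_term q n1 n2 (Suc n3) * (1 - q ^ (3 * Suc n3)) = q ^ (3 * n1 + 6 * n2 + 9 * n3 + 4) * kr_term q n1 n2 n3"
    unfolding kr_term_def kr_exponent_Suc P by (rule cancel(3)[OF nz]) simp
qed

text \<open>The difference of the two summands splits as
  \<open>(1 - q ^ (3 n3)) (-1/q; q\<^sup>2)\<^sub>n\<^sub>2 + q ^ (3 n3) ((-1/q; q\<^sup>2)\<^sub>n\<^sub>2 - (-q; q\<^sup>2)\<^sub>n\<^sub>2)\<close>. The first part is
  ready for a shift in \<open>n3\<close>; in the second, the bracket is a multiple of \<open>1 - q ^ (2 n2)\<close>, so it is ready
  for a shift in \<open>n2\<close>.\<close>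

lemma kr_sum_equation:
  "kr_sum q = kr_sum_single q + fps_const (q ^ 2) * fps_X ^ 2 * dilate (q ^ 2) (kr_sum_single q)
     + fps_const (q ^ 4) * fps_X ^ 3 * dilate (q ^ 3) (kr_sum q)"
proof -
  define u2 where "u2 = (\<lambda>(n1, n2, n3). kr_term q n1 n2 n3 * q ^ (3 * n3) * (pair_factor q n2 - pair_factor_single q n2))"
  define u3 where "u3 = (\<lambda>(n1, n2, n3). kr_term q n1 n2 n3 * (1 - q ^ (3 * n3)) * pair_factor q n2)"
  have split: "(\<lambda>(n1, n2, n3). kr_term q n1 n2 n3 * pair_factor q n2) = (\<lambda>i.
      ((case i of (n1, n2, n3) \<Rightarrow> kr_term q n1 n2 n3 * q ^ (3 * n3) * pair_factor_single q n2) + u2 i) + u3 i)"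
    by (auto simp: fun_eq_iff u2_def u3_def algebra_simps)
  have "weighted_sum kr_weight u2 = fps_X ^ 2 * weighted_sum kr_weight (\<lambda>(n1, n2, n3). u2 (n1, Suc n2, n3))"
    by (rule kr_weighted_sum_shift(2)) (simp add: u2_def)
  also have "(\<lambda>(n1, n2, n3). u2 (n1, Suc n2, n3)) = (\<lambda>i. q ^ 2 * ((q ^ 2) ^ kr_weight i *
      (case i of (n1, n2, n3) \<Rightarrow> kr_term q n1 n2 n3 * q ^ (3 * n3) * pair_factor_single q n2)))"
  proof (clarsimp simp: fun_eq_iff)
    fix n1 n2 n3
    \<comment> \<open>Both symbols are multiples of \<open>(-q; q\<^sup>2)\<^sub>n\<^sub>2\<close>, by \<open>1 + 1/q\<close> and \<open>1 + q ^ (2 n2 + 1)\<close>.\<close>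
    have diff: "pair_factor q (Suc n2) - pair_factor_single q (Suc n2) =
        (1 - q ^ (2 * Suc n2)) / q * pair_factor_single q n2"
      using q_nonzero by (simp add: pair_factor_Suc pair_factor_single_Suc field_simps)
    have "u2 (n1, Suc n2, n3) = kr_term q n1 (Suc n2) n3 * (1 - q ^ (2 * Suc n2)) / q * q ^ (3 * n3) * pair_factor_single q n2"
      unfolding u2_def prod.case diff by simp
    also have "\<dots> = q ^ (2 * n1 + 4 * n2 + 6 * n3 + 2) * kr_term q n1 n2 n3 * q ^ (3 * n3) * pair_factor_single q n2"
      unfolding kr_term_Suc using q_nonzero by (simp add: eval_nat_numeral)
    also have "2 * n1 + 4 * n2 + 6 * n3 + 2 = 2 + 2 * (3 * n3 + 2 * n2 + n1)"
      by simp
    finally show "u2 (n1, Suc n2, n3) = q\<^sup>2 * (q\<^sup>2 ^ (3 * n3 + 2 * n2 + n1) *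
        (kr_term q n1 n2 n3 * q ^ (3 * n3) * pair_factor_single q n2))"
      by (simp only: power_add power_mult mult.assoc)
  qed
  also have "weighted_sum kr_weight \<dots> = fps_const (q ^ 2) * dilate (q ^ 2) (kr_sum_single q)"
    by (simp add: weighted_sum_const dilate_weighted_sum kr_sum_single_def)
  finally have 2: "weighted_sum kr_weight u2 = fps_X ^ 2 * (fps_const (q ^ 2) * dilate (q ^ 2) (kr_sum_single q))" .
  have "weighted_sum kr_weight u3 = fps_X ^ 3 * weighted_sum kr_weight (\<lambda>(n1, n2, n3). u3 (n1, n2, Suc n3))"
    by (rule kr_weighted_sum_shift(3)) (simp add: u3_def)
  also have "(\<lambda>(n1, n2, n3). u3 (n1, n2, Suc n3)) = (\<lambda>i. q ^ 4 * ((q ^ 3) ^ kr_weight i *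
      (case i of (n1, n2, n3) \<Rightarrow> kr_term q n1 n2 n3 * pair_factor q n2)))"
  proof (clarsimp simp: fun_eq_iff)
    fix n1 n2 n3
    have "u3 (n1, n2, Suc n3) = q ^ (3 * n1 + 6 * n2 + 9 * n3 + 4) * kr_term q n1 n2 n3 * pair_factor q n2"
      unfolding u3_def prod.case kr_term_Suc ..
    then show "u3 (n1, n2, Suc n3) = q ^ 4 * ((q ^ 3) ^ (3 * n3 + 2 * n2 + n1) * (kr_term q n1 n2 n3 * pair_factor q n2))"
      by (simp add: power_add mult_ac flip: power_mult)
  qed
  also have "weighted_sum kr_weight \<dots> = fps_const (q ^ 4) * dilate (q ^ 3) (kr_sum q)"
    by (simp add: weighted_sum_const dilate_weighted_sum kr_sum_def)
  finally have 3: "weighted_sum kr_weight u3 = fps_X ^ 3 * (fps_const (q ^ 4) * dilate (q ^ 3) (kr_sum q))" .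
  show ?thesis
    by (subst kr_sum_def, subst split, subst weighted_sum_add, subst weighted_sum_add)
       (simp only: 2 3 kr_sum_single_def[symmetric], simp only: mult_ac add_ac)
qed

text \<open>Here the two summands are compared after the dilation by \<open>q\<close>, which multiplies the term of
  the first sum by \<open>q ^ (n1 + 2 n2 + 3 n3)\<close>. The identity
  \<open>(-q; q\<^sup>2)\<^sub>n = q ^ (2 n) (-1/q; q\<^sup>2)\<^sub>n + (1 - q ^ (2 n)) (-q; q\<^sup>2)\<^sub>n\<^sub>-\<^sub>1\<close> splits the difference
  into a multiple of \<open>1 - q ^ n1\<close> and a multiple of \<open>1 - q ^ (2 n2)\<close>.\<close>

lemma kr_sum_single_equation:
  "kr_sum_single q = dilate q (kr_sum q) + fps_const q * fps_X * dilate (q ^ 2) (kr_sum q)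
     + fps_const (q ^ 3) * fps_X ^ 2 * dilate (q ^ 2) (kr_sum_single q)"
proof -
  define v1 where "v1 = (\<lambda>(n1, n2, n3). kr_term q n1 n2 n3 * (1 - q ^ n1) * q ^ (2 * n2 + 3 * n3) * pair_factor q n2)"
  define v2 where "v2 = (\<lambda>(n1, n2, n3). kr_term q n1 n2 n3 * (1 - q ^ (2 * n2)) * q ^ (3 * n3) * pair_factor_single q (n2 - 1))"
  \<comment> \<open>At \<open>n = 0\<close> the truncated \<open>n - 1\<close> does no harm, since \<open>1 - q ^ 0\<close> vanishes.\<close>
  have split_pairs: "pair_factor_single q n = q ^ (2 * n) * pair_factor q n + (1 - q ^ (2 * n)) * pair_factor_single q (n - 1)" for n
    using q_nonzero by (cases n) (simp_all add: pair_factor_Suc pair_factor_single_Suc field_simps)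
  have split: "(\<lambda>(n1, n2, n3). kr_term q n1 n2 n3 * q ^ (3 * n3) * pair_factor_single q n2) = (\<lambda>i.
      (q ^ kr_weight i * (case i of (n1, n2, n3) \<Rightarrow> kr_term q n1 n2 n3 * pair_factor q n2) + v1 i) + v2 i)"
  proof (clarsimp simp: fun_eq_iff)
    fix n1 n2 n3
    have "kr_term q n1 n2 n3 * q ^ (3 * n3) * pair_factor_single q n2 =
        kr_term q n1 n2 n3 * q ^ (3 * n3) * (q ^ (2 * n2) * pair_factor q n2 + (1 - q ^ (2 * n2)) * pair_factor_single q (n2 - 1))"
      by (subst split_pairs) simp
    then show "kr_term q n1 n2 n3 * q ^ (3 * n3) * pair_factor_single q n2 =
       q ^ (3 * n3 + 2 * n2 + n1) * (kr_term q n1 n2 n3 * pair_factor q n2) + v1 (n1, n2, n3) + v2 (n1, n2, n3)"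
      by (simp add: v1_def v2_def algebra_simps power_add)
  qed
  have "weighted_sum kr_weight v1 = fps_X * weighted_sum kr_weight (\<lambda>(n1, n2, n3). v1 (Suc n1, n2, n3))"
    by (rule kr_weighted_sum_shift(1)) (simp add: v1_def)
  also have "(\<lambda>(n1, n2, n3). v1 (Suc n1, n2, n3)) = (\<lambda>i. q * ((q ^ 2) ^ kr_weight i *
      (case i of (n1, n2, n3) \<Rightarrow> kr_term q n1 n2 n3 * pair_factor q n2)))"
  proof (clarsimp simp: fun_eq_iff)
    fix n1 n2 n3
    have "v1 (Suc n1, n2, n3) = q ^ (2 * n1 + 2 * n2 + 3 * n3 + 1) * kr_term q n1 n2 n3 *
        q ^ (2 * n2 + 3 * n3) * pair_factor q n2"
      unfolding v1_def prod.case kr_term_Suc ..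
    also have "\<dots> = q ^ ((2 * n1 + 2 * n2 + 3 * n3 + 1) + (2 * n2 + 3 * n3)) * (kr_term q n1 n2 n3 * pair_factor q n2)"
      unfolding power_add by (simp only: mult_ac)
    also have "(2 * n1 + 2 * n2 + 3 * n3 + 1) + (2 * n2 + 3 * n3) = Suc (2 * (3 * n3 + 2 * n2 + n1))"
      by simp
    finally show "v1 (Suc n1, n2, n3) = q * (q\<^sup>2 ^ (3 * n3 + 2 * n2 + n1) * (kr_term q n1 n2 n3 * pair_factor q n2))"
      by (simp only: power_Suc power_mult mult.assoc)
  qed
  also have "weighted_sum kr_weight \<dots> = fps_const q * dilate (q ^ 2) (kr_sum q)"
    by (simp add: weighted_sum_const dilate_weighted_sum kr_sum_def)
  finally have 1: "weighted_sum kr_weight v1 = fps_X * (fps_const q * dilate (q ^ 2) (kr_sum q))" .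
  have "weighted_sum kr_weight v2 = fps_X ^ 2 * weighted_sum kr_weight (\<lambda>(n1, n2, n3). v2 (n1, Suc n2, n3))"
    by (rule kr_weighted_sum_shift(2)) (simp add: v2_def)
  also have "(\<lambda>(n1, n2, n3). v2 (n1, Suc n2, n3)) = (\<lambda>i. q ^ 3 * ((q ^ 2) ^ kr_weight i *
      (case i of (n1, n2, n3) \<Rightarrow> kr_term q n1 n2 n3 * q ^ (3 * n3) * pair_factor_single q n2)))"
  proof (clarsimp simp: fun_eq_iff)
    fix n1 n2 n3
    have "v2 (n1, Suc n2, n3) = q ^ (2 * n1 + 4 * n2 + 6 * n3 + 3) * kr_term q n1 n2 n3 * q ^ (3 * n3) * pair_factor_single q n2"
      unfolding v2_def prod.case kr_term_Suc by simp
    then show "v2 (n1, Suc n2, n3) = q ^ 3 * (q\<^sup>2 ^ (3 * n3 + 2 * n2 + n1) *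
        (kr_term q n1 n2 n3 * q ^ (3 * n3) * pair_factor_single q n2))"
      by (simp add: power_add mult_ac flip: power_mult)
  qed
  also have "weighted_sum kr_weight \<dots> = fps_const (q ^ 3) * dilate (q ^ 2) (kr_sum_single q)"
    by (simp add: weighted_sum_const dilate_weighted_sum kr_sum_single_def)
  finally have 2: "weighted_sum kr_weight v2 = fps_X ^ 2 * (fps_const (q ^ 3) * dilate (q ^ 2) (kr_sum_single q))" .
  show ?thesis
    by (subst kr_sum_single_def, subst split, subst weighted_sum_add, subst weighted_sum_add)
       (simp only: 1 2 dilate_weighted_sum[symmetric] kr_sum_def[symmetric], simp only: mult_ac add_ac)
qed

lemma kr_system_kr_sum: "kr_system q (kr_sum q) (kr_sum_single q)"
  unfolding kr_system_def using kr_sum_equation kr_sum_single_equation by (rule conjI)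

end

section \<open>The identities\<close>

lemma fls_X_power_neq_1: "0 < m \<Longrightarrow> (fls_X :: 'a::comm_ring_1 fls) ^ m \<noteq> 1"
proof
  assume "0 < m" "(fls_X :: 'a fls) ^ m = 1"
  then have "fls_nth ((fls_X :: 'a fls) ^ m) 0 = 1" by simp
  then show False using \<open>0 < m\<close> by (simp only: fls_X_power_nth) simp
qed

lemma gen_fun_kr_c_1_2_eq_kr_sum: "gen_fun kr_c_1_2 = kr_sum fls_X"
proof -
  have "kr_system fls_X (kr_sum fls_X) (kr_sum_single (fls_X :: rat fls))"
    by (rule kr_system_kr_sum) (simp_all add: fls_X_power_neq_1)
  moreover have "kr_series KR $ 0 = kr_sum fls_X $ 0"
    by (simp add: kr_series_nth_0 fps_nth_0_kr_sum)
  ultimately show ?thesis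
    unfolding gen_fun_kr_c_1_2
    using kr_system_unique[OF fls_X_power_neq_1 kr_system_kr_series] by blast
qed

theorem theorem16:
  defines "q \<equiv> fls_X :: rat fls"
  defines "T1 \<equiv> \<lambda>(n1, n2, n3).
      xmonom (q ^ ((9 * n3\<^sup>2 - n3) div 2 + 2 * n2\<^sup>2 + n2 + n1\<^sup>2
                    + 6 * n3 * n2 + 3 * n3 * n1 + 2 * n2 * n1 - 1)
                * (1 + q) * qpochhammer (- q) (q\<^sup>2) (n2 - 1)
                / (qpochhammer q q n1 * qpochhammer (q\<^sup>2) (q\<^sup>2) n2 * qpochhammer (q ^ 3) (q ^ 3) n3))
             (3 * n3 + 2 * n2 + n1)"
    and "T2 \<equiv> \<lambda>(n1, n3).
      xmonom (q ^ ((9 * n3\<^sup>2 - n3) div 2 + n1\<^sup>2 + 3 * n3 * n1)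
                / (qpochhammer q q n1 * qpochhammer (q ^ 3) (q ^ 3) n3))
             (3 * n3 + n1)"
    and "T3 \<equiv> \<lambda>(n1, n2, n3).
      xmonom (q ^ ((9 * n3\<^sup>2 - n3) div 2 + 2 * n2\<^sup>2 + n2 + n1\<^sup>2
                    + 6 * n3 * n2 + 3 * n3 * n1 + 2 * n2 * n1)
                * qpochhammer (- 1 / q) (q\<^sup>2) n2
                / (qpochhammer q q n1 * qpochhammer (q\<^sup>2) (q\<^sup>2) n2 * qpochhammer (q ^ 3) (q ^ 3) n3))
             (3 * n3 + 2 * n2 + n1)"
  shows "T1 summable_on {(n1, n2, n3). n2 > 0} \<and> T2 summable_on UNIV \<and> T3 summable_on UNIV \<and>
    gen_fun kr_c_1_2 = infsum T1 {(n1, n2, n3). n2 > 0} + infsum T2 UNIV \<and>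
    infsum T1 {(n1, n2, n3). n2 > 0} + infsum T2 UNIV = infsum T3 UNIV"
proof -
  have q: "q \<noteq> 0" "\<And>m. 0 < m \<Longrightarrow> q ^ m \<noteq> 1"
    by (simp_all add: q_def fls_X_power_neq_1)
  define c where "c = (\<lambda>(n1, n2, n3). kr_term q n1 n2 n3 * pair_factor q n2)"
  define S1 where "S1 = weighted_sum kr_weight (\<lambda>i. if i \<in> {(n1, n2, n3). n2 > 0} then c i else 0)"
  define v :: "nat \<times> nat \<Rightarrow> nat" where "v = (\<lambda>(n1, n3). 3 * n3 + n1)"
  define e :: "nat \<times> nat \<Rightarrow> nat \<times> nat \<times> nat" where "e = (\<lambda>(n1, n3). (n1, 0, n3))"
  have T3: "T3 = (\<lambda>i. xmonom (c i) (kr_weight i))"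
    by (auto simp: T3_def c_def kr_term_def pair_factor_def kr_exponent_def fun_eq_iff)
  have T1: "T1 i = xmonom (c i) (kr_weight i)" if i_pos: "i \<in> {(n1, n2, n3). n2 > 0}" for i
  proof -
    obtain n1 k n3 where i: "i = (n1, Suc k, n3)"
      using i_pos by (cases i) (auto simp: gr0_conv_Suc)
    \<comment> \<open>For positive \<open>n2\<close> the exponent is at least 3, so subtracting 1 does not truncate.\<close>
    obtain d where d: "kr_exponent n1 (Suc k) n3 = Suc d"
      by (simp add: kr_exponent_Suc)
    have E: "q ^ (kr_exponent n1 (Suc k) n3 - 1) * (1 + q) = q ^ kr_exponent n1 (Suc k) n3 * (1 + 1 / q)"
      unfolding d using q(1) by (simp add: field_simps)
    have "T1 i = xmonom (q ^ (kr_exponent n1 (Suc k) n3 - 1) * (1 + q) * pair_factor_single q k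
        / (qpochhammer q q n1 * qpochhammer (q\<^sup>2) (q\<^sup>2) (Suc k) * qpochhammer (q ^ 3) (q ^ 3) n3))
        (kr_weight i)"
      unfolding i T1_def prod.case pair_factor_single_def kr_exponent_def kr_weight.simps by simp
    also have "\<dots> = xmonom (c i) (kr_weight i)"
      unfolding E unfolding i c_def prod.case pair_factor_Suc[OF q(1)] kr_term_def by (simp add: mult.assoc)
    finally show ?thesis .
  qed
  have T2: "T2 = (\<lambda>j. xmonom (c (e j)) (v j))"
    by (auto simp: T2_def c_def kr_term_def pair_factor_def kr_exponent_def fun_eq_iff v_def e_def)
  have fin: "finite {j. v j = m}" for m
    by (rule finite_subset[of _ "{..m} \<times> {..m}"]) (auto simp: v_def)
  have sum3: "(T3 has_sum kr_sum q) UNIV"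
    using has_sum_xmonom[OF finite_kr_weight, of c UNIV]
    by (simp add: T3 kr_sum_def c_def)
  have "((\<lambda>i. xmonom (c i) (kr_weight i)) has_sum S1) {(n1, n2, n3). n2 > 0}"
    unfolding S1_def by (rule has_sum_xmonom[OF finite_kr_weight])
  then have sum1: "(T1 has_sum S1) {(n1, n2, n3). n2 > 0}"
    by (subst has_sum_cong[OF T1])
  have sum2: "(T2 has_sum weighted_sum v (c \<circ> e)) UNIV"
    using has_sum_xmonom[OF fin, of "c \<circ> e" UNIV] by (simp add: T2 comp_def)
  \<comment> \<open>The terms with \<open>n2 = 0\<close> are those of the two-fold sum, embedded by \<open>e\<close> without change of weight.\<close>
  have zero: "weighted_sum kr_weight (\<lambda>i. if i \<in> {(n1, n2, n3). n2 > 0} then 0 else c i)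
      = fps_X ^ 0 * weighted_sum v ((\<lambda>i. if i \<in> {(n1, n2, n3). n2 > 0} then 0 else c i) \<circ> e)"
  proof (rule weighted_sum_reindex[OF finite_kr_weight])
    show "(if i \<in> {(n1, n2, n3). n2 > 0} then 0 else c i) = 0" if "i \<notin> range e" for i
    proof (cases i)
      case (fields n1 n2 n3)
      have "(n1, 0, n3) \<in> range e"
        by (rule range_eqI[of _ _ "(n1, n3)"]) (simp add: e_def)
      then show ?thesis using that fields by auto
    qed
  qed (auto simp: inj_def e_def v_def)
  have "kr_sum q = S1 + weighted_sum v (c \<circ> e)"
  proof -
    have "kr_sum q = weighted_sum kr_weight (\<lambda>i. (if i \<in> {(n1, n2, n3). n2 > 0} then c i else 0)
        + (if i \<in> {(n1, n2, n3). n2 > 0} then 0 else c i))"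
      unfolding kr_sum_def c_def[symmetric] by (rule arg_cong[of _ _ "weighted_sum kr_weight"]) auto
    also have "\<dots> = S1 + weighted_sum kr_weight (\<lambda>i. if i \<in> {(n1, n2, n3). n2 > 0} then 0 else c i)"
      by (simp only: weighted_sum_add S1_def)
    also have "weighted_sum kr_weight (\<lambda>i. if i \<in> {(n1, n2, n3). n2 > 0} then 0 else c i)
        = weighted_sum v (c \<circ> e)"
      unfolding zero by (simp add: comp_def e_def case_prod_beta)
    finally show ?thesis .
  qed
  then show ?thesis
    unfolding infsumI[OF sum1] infsumI[OF sum2] infsumI[OF sum3] gen_fun_kr_c_1_2_eq_kr_sum q_def
    using has_sum_imp_summable[OF sum1] has_sum_imp_summable[OF sum2] has_sum_imp_summable[OF sum3]
    by simp
qed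

end
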